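(* Let $m,n$ be nonnegative integers with $p=2m+n\geq 2$, and let $\Delta\geq 5$. Let $\mathcal{G}'_\Delta$ be the family of simple graphs with maximum degree $\Delta$ and degeneracy $\Delta-1$. Then $\chi_{(m,n)}(\mathcal{G}'_\Delta)\leq 2(\Delta-1)^p p^{\Delta-1}$.
   Context: An $(m,n)$-colored mixed graph is a graph whose connections are either arcs, each colored with one of $m$ colors $\alpha_1,\dots,\alpha_m$, or edges, each colored with one of $n$ colors $\beta_1,\dots,\beta_n$, such that the underlying undirected graph (forgetting orientations and colors) is simple. A colored homomorphism of $G$ to $H$ is a vertex map sending each arc (resp. edge) of $G$ to an arc (resp. edge) of $H$ of the same color, preserving arc direction. For an $(m,n)$-colored mixed graph $G$, $\chi_{(m,n)}(G)$ is the minimum number of vertices of an $(m,n)$-colored mixed graph $H$ such that $G$ admits a colored homomorphism to $H$. For a simple undirected graph $G$, $\chi_{(m,n)}(G)$ is the maximum of $\chi_{(m,n)}(G')$ over all $(m,n)$-colored mixed graphs $G'$ with underlying graph $G$; for a family $\mathcal{F}$, $\chi_{(m,n)}(\mathcal{F})$ is the supremum over $G\in\mathcal{F}$. A graph is $d$-degenerate if every subgraph has a vertex of degree at most $d$; the degeneracy is the minimum such $d$. *)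

theory Defs
  imports Main "HOL-Library.Extended_Nat"
begin

record 'a sgraph =
  verts :: "'a set"
  edges :: "'a set set"

(* All graphs are finite. *)
definition simple_graph :: "'a sgraph \<Rightarrow> bool" where
  "simple_graph G \<longleftrightarrow>
     finite (verts G) \<and> (\<forall>e\<in>edges G. e \<subseteq> verts G \<and> card e = 2)"

definition subgraph :: "'a sgraph \<Rightarrow> 'a sgraph \<Rightarrow> bool" where
  "subgraph S G \<longleftrightarrow> simple_graph S \<and> verts S \<subseteq> verts G \<and> edges S \<subseteq> edges G"

definition degree :: "'a sgraph \<Rightarrow> 'a \<Rightarrow> nat" where
  "degree G v = card {e \<in> edges G. v \<in> e}"

(* Meaningful only if G has a vertex. *)
definition max_degree :: "'a sgraph \<Rightarrow> nat" where
  "max_degree G = Max (degree G ` verts G)"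

definition degenerate :: "nat \<Rightarrow> 'a sgraph \<Rightarrow> bool" where
  "degenerate d G \<longleftrightarrow>
     (\<forall>S. subgraph S G \<and> verts S \<noteq> {} \<longrightarrow> (\<exists>v\<in>verts S. degree S v \<le> d))"

definition degeneracy :: "'a sgraph \<Rightarrow> nat" where
  "degeneracy G = (LEAST d. degenerate d G)"

(* Arc i u v is an arc from u to v of the (i+1)-st arc color; Edge j e is an edge with
   endpoint set e of the (j+1)-st edge color. *)
datatype 'a connection = Arc nat 'a 'a | Edge nat "'a set"

primrec endpoints :: "'a connection \<Rightarrow> 'a set" where
  "endpoints (Arc i u v) = {u, v}"
| "endpoints (Edge j e) = e"

primrec color_ok :: "nat \<Rightarrow> nat \<Rightarrow> 'a connection \<Rightarrow> bool" where
  "color_ok m n (Arc i u v) \<longleftrightarrow> i < m"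
| "color_ok m n (Edge j e) \<longleftrightarrow> j < n"

primrec image_connection :: "('a \<Rightarrow> 'b) \<Rightarrow> 'a connection \<Rightarrow> 'b connection" where
  "image_connection f (Arc i u v) = Arc i (f u) (f v)"
| "image_connection f (Edge j e) = Edge j (f ` e)"

record 'a mixed_graph =
  mverts :: "'a set"
  conns :: "'a connection set"

definition underlying :: "'a mixed_graph \<Rightarrow> 'a sgraph" where
  "underlying G = \<lparr>verts = mverts G, edges = endpoints ` conns G\<rparr>"

(* The underlying graph is simple: simple_graph excludes loops, and injectivity of endpoints
   excludes parallel connections (of any kind, color or direction) between two vertices. *)
definition colored_mixed_graph :: "nat \<Rightarrow> nat \<Rightarrow> 'a mixed_graph \<Rightarrow> bool" where
  "colored_mixed_graph m n G \<longleftrightarrow>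
     (\<forall>c\<in>conns G. color_ok m n c) \<and>
     simple_graph (underlying G) \<and> inj_on endpoints (conns G)"

definition colored_hom :: "'a mixed_graph \<Rightarrow> 'b mixed_graph \<Rightarrow> ('a \<Rightarrow> 'b) \<Rightarrow> bool" where
  "colored_hom G H f \<longleftrightarrow>
     f ` mverts G \<subseteq> mverts H \<and> (\<forall>c\<in>conns G. image_connection f c \<in> conns H)"

(* Targets range over graphs on natural numbers; every finite graph is isomorphic to one. *)
definition chi_mixed :: "nat \<Rightarrow> nat \<Rightarrow> 'a mixed_graph \<Rightarrow> nat" where
  "chi_mixed m n G =
     (LEAST k. \<exists>(H :: nat mixed_graph) f.
        colored_mixed_graph m n H \<and> card (mverts H) = k \<and> colored_hom G H f)"

definition chi_graph :: "nat \<Rightarrow> nat \<Rightarrow> 'a sgraph \<Rightarrow> nat" where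
  "chi_graph m n G =
     Max {chi_mixed m n G' |G'. colored_mixed_graph m n G' \<and> underlying G' = G}"

(* Valued in enat, so that the supremum over an unbounded family is infinite. *)
definition chi_family :: "nat \<Rightarrow> nat \<Rightarrow> 'a sgraph set \<Rightarrow> enat" where
  "chi_family m n F = (SUP G\<in>F. enat (chi_graph m n G))"

definition degenerate_family :: "nat \<Rightarrow> 'a sgraph set" where
  "degenerate_family \<Delta> =
     {G. simple_graph G \<and> verts G \<noteq> {} \<and> max_degree G = \<Delta> \<and> degeneracy G = \<Delta> - 1}"

end

theory Submission
  imports Defs "HOL-Library.FuncSet" "HOL-Analysis.Harmonic_Numbers"
begin

text \<open>Put \<open>d = \<Delta> - 1\<close>. All graphs in question map to one colored mixed graph in which any
  \<open>d\<close> vertices with consistently prescribed adjacency types have at least \<open>d\<close> common neighbours;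
  hence any \<open>j \<le> d\<close> vertices have at least \<open>p ^ (d - j) * d\<close>. Vertices are coloured in a degeneracy order
  such that the conditions imposed on every uncoloured vertex stay consistent. A vertex with \<open>j\<close>
  coloured neighbours has at most \<open>d + 1 - j\<close> uncoloured ones, each with at most \<open>d - 1\<close> other
  coloured neighbours, so at most \<open>(d + 1 - j) * (d - 1)\<close> images are excluded.

  The target is random, with a union bound on exponential moments. For \<open>p = 2\<close> and \<open>d = 4\<close> the
  union bound fails for uniformly random types on 512 vertices. Therefore, for \<open>p = 2\<close>, only half
  of the vertices are chosen at random and each receives an antitwin, which has the other type
  towards every other vertex; this leaves far fewer configurations to be controlled, and conflicts with
  a coloured neighbour still exclude at most one image.\<close>

section \<open>Adjacency types\<close>

text \<open>Seen from \<open>x\<close>, a connection with \<open>y\<close> has one of \<open>2 * m + n\<close> types: an outgoing arc,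
  an incoming arc, or an edge, in this order.\<close>

definition conn :: "nat \<Rightarrow> nat \<Rightarrow> 'a \<Rightarrow> 'a \<Rightarrow> 'a connection" where
  "conn m k x y = (if k < m then Arc k x y
     else if k < 2 * m then Arc (k - m) y x else Edge (k - 2 * m) {x, y})"

text \<open>The involution on types that reads the same connection from its other end.\<close>

definition rev_type :: "nat \<Rightarrow> nat \<Rightarrow> nat" where
  "rev_type m k = (if k < m then k + m else if k < 2 * m then k - m else k)"

lemma conn_rev_type: "conn m (rev_type m k) x y = conn m k y x"
  by (auto simp: conn_def rev_type_def insert_commute)

lemma rev_type_rev_type [simp]: "rev_type m (rev_type m k) = k"
  by (auto simp: rev_type_def)

lemma rev_type_less: "k < 2 * m + n \<Longrightarrow> rev_type m k < 2 * m + n"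
  by (auto simp: rev_type_def)

lemma endpoints_conn [simp]: "endpoints (conn m k x y) = {x, y}"
  by (auto simp: conn_def)

lemma color_ok_conn: "k < 2 * m + n \<Longrightarrow> color_ok m n (conn m k x y)"
  by (auto simp: conn_def)

lemma image_conn: "image_connection f (conn m k x y) = conn m k (f x) (f y)"
  by (auto simp: conn_def)

lemma ex_conn:
  assumes "color_ok m n c" "endpoints c = {x, y}" "x \<noteq> y"
  shows "\<exists>k < 2 * m + n. c = conn m k x y"
proof (cases c)
  case (Arc i u v)
  then have i: "i < m" and "{u, v} = {x, y}" using assms by auto
  then consider "u = x" "v = y" | "u = y" "v = x" by (auto simp: doubleton_eq_iff)
  then show ?thesis
  proof cases
    case 1
    then show ?thesis using i Arc by (intro exI[of _ i]) (auto simp: conn_def)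
  next
    case 2
    then show ?thesis using i Arc by (intro exI[of _ "i + m"]) (auto simp: conn_def)
  qed
next
  case (Edge j e)
  then show ?thesis using assms by (intro exI[of _ "j + 2 * m"]) (auto simp: conn_def)
qed

text \<open>For \<open>p = 2\<close> and \<open>b\<close> true this swaps the two types
  \<open>0\<close> and \<open>1\<close>: it is the effect of replacing one end of a connection by
  its antitwin.\<close>

definition twist :: "bool \<Rightarrow> nat \<Rightarrow> nat" where
  "twist b k = (if b then 1 - k else k)"

text \<open>A target vertex is a pair of a base vertex and a layer; a second layer, which holds the
  antitwins, exists only for \<open>p = 2\<close>.\<close>

definition layers :: "nat \<Rightarrow> bool set" where
  "layers p = (if p = 2 then UNIV else {False})"

lemma finite_layers [simp]: "finite (layers p)"
  by (simp add: layers_def)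

lemma card_layers: "card (layers p) = (if p = 2 then 2 else 1)"
  by (simp add: layers_def card_UNIV_bool)

lemma twist_less: "b \<in> layers p \<Longrightarrow> k < p \<Longrightarrow> twist b k < p"
  by (auto simp: twist_def layers_def split: if_splits)

lemma twist_twist: "b \<in> layers p \<Longrightarrow> k < p \<Longrightarrow> twist b (twist b k) = k"
  by (auto simp: twist_def layers_def split: if_splits)

lemma twist_xor:
  "b \<in> layers p \<Longrightarrow> c \<in> layers p \<Longrightarrow> k < p \<Longrightarrow> twist b (twist c k) = twist (b \<noteq> c) k"
  by (auto simp: twist_def layers_def split: if_splits)

lemma xor_layers: "b \<in> layers p \<Longrightarrow> c \<in> layers p \<Longrightarrow> (b \<noteq> c) \<in> layers p"
  by (auto simp: layers_def split: if_splits)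

text \<open>If \<open>p = 2\<close>, either \<open>m = 0\<close> and reversal is the identity, or
  \<open>m = 1\<close>, \<open>n = 0\<close> and reversal is itself the swap; both commute with the
  swap. So antitwins can be introduced consistently at both ends of a connection.\<close>

lemma twist_rev_type:
  assumes "b \<in> layers (2 * m + n)" "k < 2 * m + n"
  shows "twist b (rev_type m k) = rev_type m (twist b k)"
proof (cases "2 * m + n = 2 \<and> b")
  case True
  then have "m = 0 \<or> m = 1" and "k = 0 \<or> k = 1" using assms by auto
  then show ?thesis using True by (auto simp: twist_def rev_type_def)
next
  case False
  then show ?thesis using assms by (auto simp: twist_def layers_def split: if_splits)
qed

text \<open>The swap has no fixed point among two types.\<close>

lemma twist_inj_layer:
  assumes "b \<in> layers p" "c \<in> layers p" "k < p" "twist b k = twist c k"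
  shows "b = c"
proof (cases "p = 2")
  case True
  then have "k = 0 \<or> k = 1" using assms by auto
  then show ?thesis using assms by (auto simp: twist_def split: if_splits)
qed (use assms in \<open>auto simp: layers_def\<close>)

text \<open>If \<open>p = 2\<close>, the two layers over a base vertex show both types, so one of
  them shows \<open>l\<close>; otherwise there is a single layer. Hence a conflict rules out at most
  one vertex over a given base.\<close>

lemma twist_neq_unique:
  assumes "b \<in> layers p" "c \<in> layers p" "k < p" "l < p"
    and "twist b k \<noteq> l" "twist c k \<noteq> l"
  shows "b = c"
proof (cases "p = 2")
  case True
  then have "k = 0 \<or> k = 1" "l = 0 \<or> l = 1" using assms by auto
  then show ?thesis using assms by (auto simp: twist_def split: if_splits)
qed (use assms in \<open>auto simp: layers_def\<close>)

section \<open>Rich type assignments\<close>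

text \<open>Elements of \<open>J\<close> stand for their copies in the layer \<open>False\<close>; a
  condition at an antitwin is converted by a twist before it enters \<open>a\<close>. Bases in
  \<open>J\<close> are left out because the layers over one base are kept nonadjacent.\<close>

definition cands ::
    "nat \<Rightarrow> nat \<Rightarrow> (nat \<Rightarrow> nat \<Rightarrow> nat) \<Rightarrow> nat set \<Rightarrow> (nat \<Rightarrow> nat) \<Rightarrow> (nat \<times> bool) set" where
  "cands p M \<rho> J a = {y \<in> {..<M} \<times> layers p.
     fst y \<notin> J \<and> (\<forall>x\<in>J. twist (snd y) (\<rho> x (fst y)) = a x)}"

definition rich :: "nat \<Rightarrow> nat \<Rightarrow> nat \<Rightarrow> nat \<Rightarrow> (nat \<Rightarrow> nat \<Rightarrow> nat) \<Rightarrow> bool" where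
  "rich m p M d \<rho> \<longleftrightarrow>
     (\<forall>x<M. \<forall>y<M. x \<noteq> y \<longrightarrow> \<rho> x y < p \<and> \<rho> y x = rev_type m (\<rho> x y)) \<and>
     (\<forall>J a. J \<subseteq> {..<M} \<longrightarrow> card J = d \<longrightarrow> a ` J \<subseteq> {..<p} \<longrightarrow> d \<le> card (cands p M \<rho> J a))"

lemma finite_cands [simp]: "finite (cands p M \<rho> J a)"
  by (rule finite_subset[of _ "{..<M} \<times> layers p"]) (auto simp: cands_def)

lemma cands_cong: "(\<And>x. x \<in> J \<Longrightarrow> a x = b x) \<Longrightarrow> cands p M \<rho> J a = cands p M \<rho> J b"
  by (auto simp: cands_def)

text \<open>Add a base vertex \<open>x\<close> outside \<open>D\<close>, which exists because
  \<open>card D < d \<le> M\<close>. The \<open>p\<close> possible types towards \<open>x\<close>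
  give disjoint classes of candidates, so every vertex missing from a set of size \<open>d\<close>
  contributes a factor \<open>p\<close>.\<close>

lemma rich_cands:
  assumes "rich m p M d \<rho>" "d \<le> M"
    and "D \<subseteq> {..<M}" "card D \<le> d" "a ` D \<subseteq> {..<p}"
  shows "p ^ (d - card D) * d \<le> card (cands p M \<rho> D a)"
  using assms(3-)
proof (induction "d - card D" arbitrary: D a)
  case 0
  then show ?case using assms(1) by (auto simp: rich_def)
next
  case (Suc k)
  have fin: "finite D" using Suc.prems finite_subset by blast
  have "D \<noteq> {..<M}" using Suc.hyps(2) assms(2) by auto
  then obtain x where x: "x < M" "x \<notin> D" using Suc.prems(1) by blast
  have c: "card (insert x D) = Suc (card D)" using x fin by simp
  have IH: "p ^ k * d \<le> card (cands p M \<rho> (insert x D) (a(x := l)))" if "l < p" for l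
  proof -
    have "p ^ (d - card (insert x D)) * d \<le> card (cands p M \<rho> (insert x D) (a(x := l)))"
    proof (rule Suc.hyps(1))
      show "k = d - card (insert x D)" using Suc.hyps(2) c by simp
      show "insert x D \<subseteq> {..<M}" using x Suc.prems by simp
      show "card (insert x D) \<le> d" using c Suc.hyps(2) by simp
      show "(a(x := l)) ` insert x D \<subseteq> {..<p}" using that Suc.prems by auto
    qed
    moreover have "k = d - card (insert x D)" using Suc.hyps(2) c by simp
    ultimately show ?thesis by simp
  qed
  have "p ^ (d - card D) * d = (\<Sum>l<p. p ^ k * d)"
    using Suc.hyps(2)[symmetric] by simp
  also have "\<dots> \<le> (\<Sum>l<p. card (cands p M \<rho> (insert x D) (a(x := l))))"
    using IH by (intro sum_mono) auto
  also have "\<dots> = card (\<Union>l<p. cands p M \<rho> (insert x D) (a(x := l)))"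
    by (rule card_UN_disjoint[symmetric]) (auto simp: cands_def)
  also have "\<dots> \<le> card (cands p M \<rho> D a)"
  proof (rule card_mono)
    show "(\<Union>l<p. cands p M \<rho> (insert x D) (a(x := l))) \<subseteq> cands p M \<rho> D a"
      using x(2) by (auto simp: cands_def)
  qed simp
  finally show ?case .
qed

section \<open>Greedy colouring\<close>

lemma card_conflicts_le_1:
  fixes M k l p :: nat
  assumes "k < p" "l < p"
  shows "card {y \<in> {..<M} \<times> layers p. fst y = z \<and> twist (snd y) k \<noteq> l} \<le> 1"
proof (rule card_le_Suc0_iff_eq[THEN iffD2, unfolded One_nat_def[symmetric]])
  show "finite {y \<in> {..<M} \<times> layers p. fst y = z \<and> twist (snd y) k \<noteq> l}"
    by (rule finite_subset[of _ "{..<M} \<times> layers p"]) auto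
  show "\<forall>y\<in>{y \<in> {..<M} \<times> layers p. fst y = z \<and> twist (snd y) k \<noteq> l}.
        \<forall>y'\<in>{y \<in> {..<M} \<times> layers p. fst y = z \<and> twist (snd y) k \<noteq> l}. y = y'"
    using twist_neq_unique[OF _ _ assms] by (auto simp: prod_eq_iff)
qed

text \<open>Excluded images against available ones. The first factors compare by
  \<open>k + 1 \<le> 2 ^ k\<close>, and strictness comes from \<open>d - 1 < d\<close>.\<close>

lemma forbidden_less:
  assumes "2 \<le> (p :: nat)" "0 < d" "j \<le> d"
  shows "(d + 1 - j) * (d - 1) < p ^ (d - j) * d"
proof -
  have "d + 1 - j \<le> 2 ^ (d - j)"
    using less_exp[of "d - j"] assms(3) by linarith
  also have "\<dots> \<le> p ^ (d - j)" using assms(1) by (rule power_mono) simp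
  finally show ?thesis using assms
    by (intro mult_le_less_imp_less) auto
qed

text \<open>An antitwin at either end swaps the type, so the swaps cancel when both ends are
  antitwins.\<close>

definition target_type :: "(nat \<Rightarrow> nat \<Rightarrow> nat) \<Rightarrow> nat \<times> bool \<Rightarrow> nat \<times> bool \<Rightarrow> nat" where
  "target_type \<rho> y z = twist (snd y \<noteq> snd z) (\<rho> (fst y) (fst z))"

text \<open>The last conjunct of the invariant says that the types prescribed to an uncoloured vertex
  by its coloured neighbours remain jointly realisable. Each coloured neighbour of an uncoloured
  neighbour of \<open>v\<close> excludes at most one image of \<open>v\<close>.\<close>

lemma greedy_coloring:
  fixes t :: "'a \<Rightarrow> 'a \<Rightarrow> nat" and N :: "'a \<Rightarrow> 'a set"
  assumes p: "p = 2 * m + n" "2 \<le> p" and d: "0 < d" "d \<le> M" and richh: "rich m p M d \<rho>"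
    and nsym: "\<And>u v. u \<in> N v \<Longrightarrow> v \<in> N u" and irrf: "\<And>v. v \<notin> N v"
    and subN: "\<And>v. N v \<subseteq> set vs"
    and deg: "\<And>v. v \<in> set vs \<Longrightarrow> card (N v) \<le> d + 1"
    and t: "\<And>u v. u \<in> N v \<Longrightarrow> t u v < p \<and> t v u = rev_type m (t u v)"
    and dist: "distinct vs"
    and prefix: "\<And>xs v ys. vs = xs @ v # ys \<Longrightarrow> card (set xs \<inter> N v) \<le> d"
    and "vs = xs @ ys"
  shows "\<exists>f. f ` set xs \<subseteq> {..<M} \<times> layers p \<and>
    (\<forall>v\<in>set xs. \<forall>w\<in>set xs. w \<in> N v \<longrightarrow> fst (f v) \<noteq> fst (f w) \<and> target_type \<rho> (f w) (f v) = t w v) \<and>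
    (\<forall>u\<in>set ys. \<forall>w\<in>set xs \<inter> N u. \<forall>w'\<in>set xs \<inter> N u. fst (f w) = fst (f w') \<longrightarrow>
        twist (snd (f w)) (t w u) = twist (snd (f w')) (t w' u))"
  using \<open>vs = xs @ ys\<close>
proof (induction xs arbitrary: ys rule: rev_induct)
  case Nil
  then show ?case by simp
next
  case (snoc v xs)
  then have vs: "vs = xs @ v # ys" by simp
  define S where "S = set xs"
  have t_less: "t u w < p" if "u \<in> N w" for u w using t[OF that] by simp
  obtain f where f: "f ` S \<subseteq> {..<M} \<times> layers p"
    and hom: "\<forall>v\<in>S. \<forall>w\<in>S. w \<in> N v \<longrightarrow>
       fst (f v) \<noteq> fst (f w) \<and> target_type \<rho> (f w) (f v) = t w v"
    and cons: "\<forall>u\<in>set (v # ys). \<forall>w\<in>S \<inter> N u. \<forall>w'\<in>S \<inter> N u. fst (f w) = fst (f w') \<longrightarrow>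
       twist (snd (f w)) (t w u) = twist (snd (f w')) (t w' u)"
    using snoc.IH[OF vs] unfolding S_def[symmetric] by (elim exE conjE)
  have consD: "twist (snd (f w)) (t w u) = twist (snd (f w')) (t w' u)"
    if "u \<in> set (v # ys)" "w \<in> S" "w \<in> N u" "w' \<in> S" "w' \<in> N u" "fst (f w) = fst (f w')" for u w w'
    using cons that by blast
  have vS: "v \<notin> S" using dist vs by (auto simp: S_def)
  have finS [simp]: "finite S" by (simp add: S_def)
  have finN [simp]: "finite (N u)" for u using subN finite_subset by blast
  have lay: "snd (f w) \<in> layers p" "fst (f w) < M" if "w \<in> S" for w using f that by auto
  have \<rho>: "\<rho> x y < p" "\<rho> y x = rev_type m (\<rho> x y)" if "x < M" "y < M" "x \<noteq> y" for x y
    using richh that unfolding rich_def by blast+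
  define D where "D = (fst \<circ> f) ` (S \<inter> N v)"
  \<comment> \<open>By the invariant, coloured neighbours of \<open>v\<close> over the same base
    impose the same converted condition. Conditions are thus a function of the base vertex, and any
    representative \<open>w\<close> may be chosen.\<close>
  define a where "a x = (let w = SOME w. w \<in> S \<inter> N v \<and> fst (f w) = x
    in twist (snd (f w)) (t w v))" for x
  have a: "a (fst (f w)) = twist (snd (f w)) (t w v)" if "w \<in> S \<inter> N v" for w
  proof -
    define w' where "w' = (SOME w'. w' \<in> S \<inter> N v \<and> fst (f w') = fst (f w))"
    have "w' \<in> S \<inter> N v \<and> fst (f w') = fst (f w)"
      unfolding w'_def by (rule someI[of _ w]) (use that in simp)
    then have "twist (snd (f w')) (t w' v) = twist (snd (f w)) (t w v)"
      using that by (intro consD) simp_all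
    then show ?thesis by (simp only: a_def w'_def[symmetric] Let_def)
  qed
  define j where "j = card (S \<inter> N v)"
  have "j \<le> d" using prefix[OF vs] by (simp add: j_def S_def)
  have Dj: "card D \<le> j" unfolding D_def j_def by (rule card_image_le) simp
  \<comment> \<open>Neighbours sharing a base make \<open>D\<close> smaller than \<open>j\<close>,
    which only leaves more candidates.\<close>
  have "p ^ (d - j) * d \<le> p ^ (d - card D) * d"
    using Dj p(2) by (intro mult_right_mono power_increasing) auto
  also have "\<dots> \<le> card (cands p M \<rho> D a)"
  proof (rule rich_cands[OF richh d(2)])
    show "D \<subseteq> {..<M}" using f by (auto simp: D_def)
    show "card D \<le> d" using Dj \<open>j \<le> d\<close> by simp
    show "a ` D \<subseteq> {..<p}"
      using a lay t_less twist_less by (auto simp: D_def)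
  qed
  finally have many: "p ^ (d - j) * d \<le> card (cands p M \<rho> D a)" .
  \<comment> \<open>The images of \<open>v\<close> that would contradict, at the uncoloured vertex
    \<open>u\<close>, the condition already imposed by \<open>w\<close>.\<close>
  define confl where "confl u w = {y \<in> {..<M} \<times> layers p.
    fst y = fst (f w) \<and> twist (snd y) (t v u) \<noteq> twist (snd (f w)) (t w u)}" for u w
  define F where "F = (\<Union>u\<in>N v - S. \<Union>w\<in>S \<inter> N u. confl u w)"
  have "card F \<le> (\<Sum>u\<in>N v - S. card (\<Union>w\<in>S \<inter> N u. confl u w))"
    unfolding F_def by (rule card_UN_le) simp
  also have "\<dots> \<le> (\<Sum>u\<in>N v - S. d - 1)"
  proof (rule sum_mono)
    fix u assume u: "u \<in> N v - S"
    then have "u \<in> set ys" using subN[of v] vs irrf[of v] by (auto simp: S_def)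
    then obtain ys1 ys2 where "ys = ys1 @ u # ys2" by (auto dest: split_list)
    then have "vs = (xs @ v # ys1) @ u # ys2" using vs by simp
    from prefix[OF this] have "card (set (xs @ v # ys1) \<inter> N u) \<le> d" .
    \<comment> \<open>The vertex \<open>v\<close> is itself one of the at most \<open>d\<close>
      earlier neighbours of \<open>u\<close>, which leaves \<open>d - 1\<close> for
      \<open>S\<close>.\<close>
    moreover have "card (insert v (S \<inter> N u)) \<le> card (set (xs @ v # ys1) \<inter> N u)"
      using u nsym[of u v] by (intro card_mono) (auto simp: S_def)
    ultimately have c: "card (S \<inter> N u) \<le> d - 1" using vS by simp
    have "card (\<Union>w\<in>S \<inter> N u. confl u w) \<le> (\<Sum>w\<in>S \<inter> N u. card (confl u w))"
      by (rule card_UN_le) simp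
    also have "\<dots> \<le> (\<Sum>w\<in>S \<inter> N u. 1)"
    proof (rule sum_mono)
      fix w assume w: "w \<in> S \<inter> N u"
      show "card (confl u w) \<le> 1"
        unfolding confl_def
        by (rule card_conflicts_le_1) (use u w t_less[of v u] t_less[of w u] nsym[of u v] lay[of w] twist_less in auto)
    qed
    finally show "card (\<Union>w\<in>S \<inter> N u. confl u w) \<le> d - 1" using c by simp
  qed
  also have "\<dots> = card (N v - S) * (d - 1)" by simp
  also have "card (N v - S) = card (N v) - j"
    by (simp add: j_def card_Diff_subset_Int Int_commute)
  also have "(card (N v) - j) * (d - 1) \<le> (d + 1 - j) * (d - 1)"
    using deg[of v] vs by (intro mult_right_mono diff_le_mono) auto
  also have "\<dots> < p ^ (d - j) * d" using forbidden_less[OF p(2) d(1) \<open>j \<le> d\<close>] .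
  also note many
  finally have "card F < card (cands p M \<rho> D a)" .
  moreover have "finite F" unfolding F_def confl_def
    by (intro finite_UN_I finite_Diff finite_Int) (auto intro: finite_subset[of _ "{..<M} \<times> layers p"])
  ultimately have "\<not> cands p M \<rho> D a \<subseteq> F" using card_mono leD by blast
  then obtain y where y: "y \<in> cands p M \<rho> D a" "y \<notin> F" by blast
  have yW: "fst y < M" "snd y \<in> layers p" and yD: "fst y \<notin> D" using y by (auto simp: cands_def)
  have new: "fst (f w) \<noteq> fst y" "target_type \<rho> (f w) y = t w v" "target_type \<rho> y (f w) = t v w"
    if w: "w \<in> S \<inter> N v" for w
  proof -
    have "fst (f w) \<in> D" using w by (auto simp: D_def)
    then show ne: "fst (f w) \<noteq> fst y" using yD by metis
    let ?r = "\<rho> (fst (f w)) (fst y)"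
    have r: "?r < p" "\<rho> (fst y) (fst (f w)) = rev_type m ?r" 
      using \<rho>[of "fst (f w)" "fst y"] lay[of w] yW w ne by blast+
    have "twist (snd y) ?r = twist (snd (f w)) (t w v)"
      using y(1) a[OF w] \<open>fst (f w) \<in> D\<close> by (auto simp: cands_def)
    \<comment> \<open>Twisting by the layer of \<open>f w\<close> undoes the conversion made in
      \<open>a\<close>.\<close>
    then have "twist (snd (f w)) (twist (snd y) ?r) = t w v"
      using twist_twist[of _ p] lay[of w] w t_less[of w v] by simp
    then show 1: "target_type \<rho> (f w) y = t w v"
      using twist_xor[of "snd (f w)" p "snd y"] lay w yW r by (simp add: target_type_def)
    have "(snd (f w) \<noteq> snd y) \<in> layers p" using lay w yW by (intro xor_layers) auto
    then show "target_type \<rho> y (f w) = t v w"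
      using 1 t[of w v] w r(1) twist_rev_type[of "snd (f w) \<noteq> snd y" m n ?r] p(1)
      unfolding target_type_def r(2) neq_commute[of "snd y"] by simp
  qed
  define g where "g = f(v := y)"
  have gv: "g v = y" and gS: "\<And>w. w \<in> S \<Longrightarrow> g w = f w" using vS by (auto simp: g_def)
  have xs: "set (xs @ [v]) = insert v S" by (simp add: S_def)
  show ?case
  proof (intro exI[of _ g] conjI ballI impI; unfold xs)
    show "g ` insert v S \<subseteq> {..<M} \<times> layers p"
      using f gS yW by (auto simp: gv mem_Times_iff)
  next
    fix x w assume "x \<in> insert v S" "w \<in> insert v S" "w \<in> N x"
    then consider "x \<in> S" "w \<in> S" "w \<in> N x" | "x = v" "w \<in> S \<inter> N v" | "w = v" "x \<in> S \<inter> N v"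
      using irrf[of v] nsym[of w x] by blast
    then have "fst (g x) \<noteq> fst (g w) \<and> target_type \<rho> (g w) (g x) = t w x"
    proof cases
      case 1
      then show ?thesis using hom gS by auto
    next
      case 2
      then show ?thesis using new[of w] gS gv by auto
    next
      case 3
      then show ?thesis using new[of x] gS gv by auto
    qed
    then show "fst (g x) \<noteq> fst (g w)" "target_type \<rho> (g w) (g x) = t w x" by blast+
  next
    fix u w w'
    assume u: "u \<in> set ys" and w: "w \<in> insert v S \<inter> N u" and w': "w' \<in> insert v S \<inter> N u"
      and eq: "fst (g w) = fst (g w')"
    have uS: "u \<notin> S" using u dist vs by (auto simp: S_def)
    \<comment> \<open>Otherwise \<open>y\<close> would be among the images excluded for the sake of
      \<open>u\<close>.\<close>
    have key: "twist (snd y) (t v u) = twist (snd (f w)) (t w u)"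
      if "v \<in> N u" "w \<in> S \<inter> N u" "fst y = fst (f w)" for w
    proof (rule ccontr)
      assume "\<not> ?thesis"
      then have "y \<in> confl u w" using that yW by (auto simp: confl_def mem_Times_iff)
      then have "y \<in> F" using that uS nsym[of v u] by (auto simp: F_def)
      then show False using y by simp
    qed
    show "twist (snd (g w)) (t w u) = twist (snd (g w')) (t w' u)"
    proof (cases "w = v"; cases "w' = v")
      assume "w \<noteq> v" "w' \<noteq> v"
      then have "twist (snd (f w)) (t w u) = twist (snd (f w')) (t w' u)"
        using u w w' eq gS by (intro consD) simp_all
      then show ?thesis using \<open>w \<noteq> v\<close> \<open>w' \<noteq> v\<close> w w' gS by simp
    qed (use key[of w] key[of w'] w w' eq gv gS in auto)
  qed
qed

section \<open>A random type assignment is rich\<close>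

text \<open>Independence of disjoint blocks in counting form: by restricting and gluing, a function
  on \<open>P\<close> is a choice of one function on each fibre \<open>A i\<close> of
  \<open>k\<close>, so the product of sums expands into a single sum.\<close>

lemma sum_PiE_blocks:
  fixes F :: "'i \<Rightarrow> ('a \<Rightarrow> 'b) \<Rightarrow> 'c :: comm_semiring_1"
  assumes "finite P" "finite T" "finite I" "k ` P \<subseteq> I"
  defines "A \<equiv> \<lambda>i. {x \<in> P. k x = i}"
  shows "(\<Sum>f\<in>PiE P (\<lambda>_. T). \<Prod>i\<in>I. F i (restrict f (A i))) =
    (\<Prod>i\<in>I. \<Sum>h\<in>PiE (A i) (\<lambda>_. T). F i h)"
proof -
  have "(\<Prod>i\<in>I. \<Sum>h\<in>PiE (A i) (\<lambda>_. T). F i h) =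
      (\<Sum>g\<in>PiE I (\<lambda>i. PiE (A i) (\<lambda>_. T)). \<Prod>i\<in>I. F i (g i))"
    using assms by (intro prod_sum_PiE finite_PiE) auto
  also have "\<dots> = (\<Sum>f\<in>PiE P (\<lambda>_. T). \<Prod>i\<in>I. F i (restrict f (A i)))"
  proof (rule sum.reindex_bij_witness[where i = "\<lambda>f. \<lambda>i\<in>I. restrict f (A i)" and j = "\<lambda>g. \<lambda>x\<in>P. g (k x) x"])
    fix g assume g: "g \<in> PiE I (\<lambda>i. PiE (A i) (\<lambda>_. T))"
    have gA: "g i \<in> PiE (A i) (\<lambda>_. T)" if "i \<in> I" for i using g that by auto
    have r: "restrict (\<lambda>x\<in>P. g (k x) x) (A i) = g i" if "i \<in> I" for i
    proof
      fix x show "restrict (\<lambda>x\<in>P. g (k x) x) (A i) x = g i x"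
        using gA[OF that] by (auto simp: A_def restrict_def PiE_def extensional_def)
    qed
    show "(\<lambda>i\<in>I. restrict (\<lambda>x\<in>P. g (k x) x) (A i)) = g"
      using g r by (auto simp: fun_eq_iff PiE_def extensional_def)
    show "(\<lambda>x\<in>P. g (k x) x) \<in> PiE P (\<lambda>_. T)"
      using gA assms(4) by (fastforce simp: A_def)
    show "(\<Prod>i\<in>I. F i (restrict (\<lambda>x\<in>P. g (k x) x) (A i))) = (\<Prod>i\<in>I. F i (g i))"
      using r by (intro prod.cong) auto
  next
    fix f assume f: "f \<in> PiE P (\<lambda>_. T)"
    show "(\<lambda>i\<in>I. restrict f (A i)) \<in> PiE I (\<lambda>i. PiE (A i) (\<lambda>_. T))"
      using f by (auto simp: A_def split: if_splits)
    show "(\<lambda>x\<in>P. (\<lambda>i\<in>I. restrict f (A i)) (k x) x) = f"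
      using f assms(4) by (auto simp: fun_eq_iff A_def PiE_def extensional_def restrict_def)
  qed
  finally show ?thesis by simp
qed

text \<open>One orientation of each pair: types on these pairs are free choices, and
  \<open>sym_type\<close> forces those on the reversed pairs.\<close>

definition up_pairs :: "nat \<Rightarrow> (nat \<times> nat) set" where
  "up_pairs M = {(x, y). x < y \<and> y < M}"

definition up :: "nat \<Rightarrow> nat \<Rightarrow> nat \<times> nat" where
  "up x y = (if x < y then (x, y) else (y, x))"

definition sym_type :: "nat \<Rightarrow> (nat \<times> nat \<Rightarrow> nat) \<Rightarrow> nat \<Rightarrow> nat \<Rightarrow> nat" where
  "sym_type m r x y = (if x < y then r (x, y) else rev_type m (r (y, x)))"

lemma finite_up_pairs [simp]: "finite (up_pairs M)"
  by (rule finite_subset[of _ "{..<M} \<times> {..<M}"]) (auto simp: up_pairs_def)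

lemma sym_type_up: "x \<noteq> y \<Longrightarrow> r (up x y) = r' (up x y) \<Longrightarrow> sym_type m r x y = sym_type m r' x y"
  by (auto simp: sym_type_def up_def)

text \<open>Exponential moment of the number of candidates: the types between \<open>J\<close> and distinct outside
  vertices \<open>y\<close> are independent, and each layer over \<open>y\<close> matches \<open>a\<close> for one of the
  \<open>p ^ d\<close> type vectors.\<close>

lemma sum_power_cands_le:
  fixes \<mu> :: real
  assumes p: "p = 2 * m + n" "2 \<le> p" and \<mu>: "0 < \<mu>" "\<mu> < 1"
    and J: "J \<subseteq> {..<M}" "card J = d" "0 < d" and a: "a ` J \<subseteq> {..<p}"
  defines "\<Omega> \<equiv> PiE (up_pairs M) (\<lambda>_. {..<p})"
  shows "(\<Sum>r\<in>\<Omega>. \<mu> ^ card (cands p M (sym_type m r) J a)) \<le>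
    card \<Omega> * (1 - (1 - \<mu>) * card (layers p) / p ^ d) ^ (M - d)"
proof -
  \<comment> \<open>The block \<open>Some y\<close> holds the pairs between \<open>J\<close> and the
    outside vertex \<open>y\<close>. All remaining pairs form the block \<open>None\<close>, on
    which the candidates do not depend.\<close>
  define k where "k = (\<lambda>(x, y). if x \<in> J \<and> y \<notin> J then Some y
     else if x \<notin> J \<and> y \<in> J then Some x else None)"
  define Y where "Y = {..<M} - J"
  define I where "I = insert None (Some ` Y)"
  define A where "A i = {x \<in> up_pairs M. k x = i}" for i
  have finJ: "finite J" using J finite_subset by blast
  have finY [simp]: "finite Y" by (simp add: Y_def)
  have cardY: "card Y = M - d" using J finJ by (simp add: Y_def card_Diff_subset)
  have kI: "k ` up_pairs M \<subseteq> I" by (auto simp: k_def I_def Y_def up_pairs_def split: if_splits)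
  have finA [simp]: "finite (A i)" for i by (simp add: A_def)
  define L where "L r y = {c \<in> layers p. \<forall>x\<in>J. twist c (sym_type m r x y) = a x}" for r y
  define T where "T = {..<p}"
  have [simp]: "finite T" by (simp add: T_def)
  have A_Some: "A (Some y) = (\<lambda>x. up x y) ` J" if "y \<in> Y" for y
  proof
    show "A (Some y) \<subseteq> (\<lambda>x. up x y) ` J"
      by (auto simp: A_def k_def up_def up_pairs_def image_iff split: if_splits)
    show "(\<lambda>x. up x y) ` J \<subseteq> A (Some y)"
    proof (rule image_subsetI)
      fix x assume "x \<in> J"
      then have "x \<noteq> y" using that by (auto simp: Y_def)
      then show "up x y \<in> A (Some y)"
        using that J(1) \<open>x \<in> J\<close> by (auto simp: A_def k_def up_def up_pairs_def Y_def)
    qed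
  qed
  have inj: "inj_on (\<lambda>x. up x y) J" if "y \<in> Y" for y
    using that by (auto simp: inj_on_def up_def Y_def split: if_splits)
  have cardA: "card (A (Some y)) = d" if "y \<in> Y" for y
    using A_Some[OF that] card_image[OF inj[OF that]] J by simp
  have L_cong: "L (restrict r (A (Some y))) y = L r y" if "y \<in> Y" for r y
  proof -
    have "sym_type m (restrict r (A (Some y))) x y = sym_type m r x y" if "x \<in> J" for x
      using that \<open>y \<in> Y\<close> by (intro sym_type_up) (auto simp: A_Some Y_def)
    then show ?thesis by (simp add: L_def)
  qed
  \<comment> \<open>A single vertex of \<open>J\<close> already tells the two layers over
    \<open>y\<close> apart; it exists because \<open>0 < d\<close>.\<close>
  have L1: "card (L h y) \<le> 1" if "y \<in> Y" "h \<in> PiE (A (Some y)) (\<lambda>_. T)" for h y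
  proof -
    obtain x where x: "x \<in> J" using J by fastforce
    then have "h (up x y) < p" using that A_Some[OF that(1)] by (auto simp: T_def)
    then have "sym_type m h x y < p"
      using rev_type_less p(1) by (auto simp: sym_type_def up_def split: if_splits)
    then have "b = c" if "b \<in> L h y" "c \<in> L h y" for b c
      using x that twist_inj_layer[of b p c "sym_type m h x y"] by (simp add: L_def)
    moreover have "finite (L h y)" by (simp add: L_def)
    ultimately show ?thesis by (auto simp: card_le_Suc0_iff_eq)
  qed
  have block: "(\<Sum>h\<in>PiE (A (Some y)) (\<lambda>_. T). \<mu> ^ card (L h y)) \<le> p ^ d - (1 - \<mu>) * card (layers p)"
    if y: "y \<in> Y" for y
  proof -
    let ?B = "PiE (A (Some y)) (\<lambda>_. T)"
    have fB: "finite ?B" by (intro finite_PiE) auto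
    \<comment> \<open>On the values \<open>0\<close> and \<open>1\<close> the power is linear in the
      exponent, so only the total number of matches matters.\<close>
    have "(\<Sum>h\<in>?B. \<mu> ^ card (L h y)) = (\<Sum>h\<in>?B. 1 - (1 - \<mu>) * card (L h y))"
    proof (rule sum.cong)
      fix h assume "h \<in> ?B"
      then have "card (L h y) = 0 \<or> card (L h y) = 1" using L1[OF y] by (simp add: le_Suc_eq)
      then show "\<mu> ^ card (L h y) = 1 - (1 - \<mu>) * card (L h y)" by auto
    qed simp
    also have "\<dots> = card ?B - (1 - \<mu>) * (\<Sum>h\<in>?B. card (L h y))"
      by (simp add: sum_subtractf sum_distrib_left)
    also have "card ?B = p ^ d" using cardA[OF y] by (simp add: card_PiE T_def)
    finally have eq: "(\<Sum>h\<in>?B. \<mu> ^ card (L h y)) = p ^ d - (1 - \<mu>) * (\<Sum>h\<in>?B. card (L h y))"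
      by simp
    have "(\<Sum>h\<in>?B. card (L h y)) = (\<Sum>h\<in>?B. \<Sum>c\<in>layers p. if c \<in> L h y then 1 else 0)"
      by (intro sum.cong refl) (simp add: L_def flip: sum.inter_filter)
    also have "\<dots> = (\<Sum>c\<in>layers p. \<Sum>h\<in>?B. if c \<in> L h y then 1 else 0)"
      by (rule sum.swap)
    also have "\<dots> \<ge> (\<Sum>c\<in>layers p. 1)"
    proof (rule sum_mono)
      fix c assume c: "c \<in> layers p"
      \<comment> \<open>The type vector under which layer \<open>c\<close> over \<open>y\<close>
        matches \<open>a\<close>: the required types are twisted back, and reversed where the stored
        pair starts at \<open>y\<close>.\<close>
      define h where "h = (\<lambda>q\<in>A (Some y). let x = (if fst q \<in> J then fst q else snd q) in
         if fst q \<in> J then twist c (a x) else rev_type m (twist c (a x)))"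
      have a': "a x < p" if "x \<in> J" for x using a that by auto
      have yJ: "y \<notin> J" using y by (simp add: Y_def)
      have "h \<in> ?B"
        unfolding h_def A_Some[OF y] T_def
        using a' twist_less[OF c] rev_type_less p(1) yJ by (auto simp: up_def Let_def)
      moreover have "c \<in> L h y"
      proof -
        have "twist c (sym_type m h x y) = a x" if x: "x \<in> J" for x
        proof -
          have "x \<noteq> y" using x yJ by auto
          moreover have "up x y \<in> A (Some y)" using A_Some[OF y] x by simp
          ultimately have "sym_type m h x y = twist c (a x)"
            using x yJ by (auto simp: sym_type_def h_def up_def split: if_splits)
          then show ?thesis using twist_twist[OF c a'[OF x]] by simp
        qed
        then show ?thesis using c by (simp add: L_def)
      qed
      ultimately have "(\<Sum>h\<in>{h}. if c \<in> L h y then 1 else 0 :: nat) \<le> (\<Sum>h\<in>?B. if c \<in> L h y then 1 else 0)"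
        using fB by (intro sum_mono2) auto
      then show "1 \<le> (\<Sum>h\<in>?B. if c \<in> L h y then 1 else 0 :: nat)" using \<open>c \<in> L h y\<close> by simp
    qed
    finally have "card (layers p) \<le> (\<Sum>h\<in>?B. card (L h y))" by simp
    then have "(1 - \<mu>) * card (layers p) \<le> (1 - \<mu>) * (\<Sum>h\<in>?B. card (L h y))"
      using \<mu> by (intro mult_left_mono) (auto simp flip: of_nat_sum)
    then show ?thesis using eq by simp
  qed
  define F where "F i h = (case i of None \<Rightarrow> 1 | Some y \<Rightarrow> \<mu> ^ card (L h y))" for i h
  have cands: "\<mu> ^ card (cands p M (sym_type m r) J a) = (\<Prod>i\<in>I. F i (restrict r (A i)))" for r
  proof -
    have "cands p M (sym_type m r) J a = Sigma Y (L r)"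
      by (auto simp: cands_def Y_def L_def)
    then have "card (cands p M (sym_type m r) J a) = (\<Sum>y\<in>Y. card (L r y))"
      by (simp add: L_def)
    then have "\<mu> ^ card (cands p M (sym_type m r) J a) = (\<Prod>y\<in>Y. \<mu> ^ card (L r y))"
      by (simp add: power_sum)
    also have "\<dots> = (\<Prod>y\<in>Y. F (Some y) (restrict r (A (Some y))))"
      by (intro prod.cong) (simp_all add: F_def L_cong)
    also have "\<dots> = (\<Prod>i\<in>I. F i (restrict r (A i)))"
      by (simp add: I_def prod.reindex) (simp add: F_def)
    finally show ?thesis .
  qed
  \<comment> \<open>The same factorisation with all factors \<open>1\<close> counts the assignments
    block by block.\<close>
  have card\<Omega>: "real (card \<Omega>) = card (PiE (A None) (\<lambda>_. T)) * (p ^ d) ^ (M - d)"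
  proof -
    have "(\<Sum>f\<in>\<Omega>. \<Prod>i\<in>I. 1 :: real) = (\<Prod>i\<in>I. \<Sum>h\<in>PiE (A i) (\<lambda>_. T). 1)"
      unfolding \<Omega>_def A_def T_def
      by (rule sum_PiE_blocks) (use kI in \<open>auto simp: I_def\<close>)
    also have "\<dots> = card (PiE (A None) (\<lambda>_. T)) * (\<Prod>y\<in>Y. real (card (PiE (A (Some y)) (\<lambda>_. T))))"
      by (simp add: I_def prod.reindex)
    also have "(\<Prod>y\<in>Y. real (card (PiE (A (Some y)) (\<lambda>_. T)))) = (\<Prod>y\<in>Y. real (p ^ d))"
      by (intro prod.cong refl) (simp add: card_PiE cardA T_def)
    finally show ?thesis by (simp add: cardY)
  qed
  have "(\<Sum>r\<in>\<Omega>. \<mu> ^ card (cands p M (sym_type m r) J a)) =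
      (\<Sum>r\<in>\<Omega>. \<Prod>i\<in>I. F i (restrict r (A i)))"
    by (simp add: cands)
  also have "\<dots> = (\<Prod>i\<in>I. \<Sum>h\<in>PiE (A i) (\<lambda>_. T). F i h)"
    unfolding \<Omega>_def A_def T_def
    by (rule sum_PiE_blocks) (use kI in \<open>auto simp: I_def\<close>)
  also have "\<dots> = card (PiE (A None) (\<lambda>_. T)) *
      (\<Prod>y\<in>Y. \<Sum>h\<in>PiE (A (Some y)) (\<lambda>_. T). \<mu> ^ card (L h y))"
    by (simp add: I_def prod.reindex) (simp add: F_def)
  also have "\<dots> \<le> card (PiE (A None) (\<lambda>_. T)) * (\<Prod>y\<in>Y. p ^ d - (1 - \<mu>) * card (layers p))"
    using \<mu> block by (intro mult_left_mono prod_mono conjI sum_nonneg) auto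
  also have "\<dots> = card (PiE (A None) (\<lambda>_. T)) * (p ^ d) ^ (M - d) *
      ((p ^ d - (1 - \<mu>) * card (layers p)) / p ^ d) ^ (M - d)"
    using p(2) by (simp add: cardY power_divide)
  also have "(p ^ d - (1 - \<mu>) * card (layers p)) / p ^ d = 1 - (1 - \<mu>) * card (layers p) / p ^ d"
    using p(2) by (simp add: diff_divide_distrib)
  finally show ?thesis by (simp add: card\<Omega>)
qed

text \<open>Markov's inequality with a union bound. If every assignment failed, each would have a
  pair \<open>(J, a)\<close> with at most \<open>d - 1\<close> candidates, whose weight
  \<open>s ^ (d - 1) * (1 / s) ^ X\<close> is at least \<open>1\<close>; summing the weights over
  all pairs and assignments contradicts \<open>small\<close>. The parameter \<open>s\<close> is free
  to be optimised.\<close>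

lemma ex_rich:
  fixes s :: real
  assumes p: "p = 2 * m + n" "2 \<le> p" and s: "1 < s" and d: "0 < d"
    and small: "(M choose d) * p ^ d * s ^ (d - 1) *
      (1 - (1 - 1 / s) * card (layers p) / p ^ d) ^ (M - d) < 1"
  shows "\<exists>\<rho>. rich m p M d \<rho>"
proof (rule ccontr)
  assume none: "\<nexists>\<rho>. rich m p M d \<rho>"
  define \<Omega> where "\<Omega> = PiE (up_pairs M) (\<lambda>_. {..<p})"
  define Q where "Q = (SIGMA J:{J. J \<subseteq> {..<M} \<and> card J = d}. PiE J (\<lambda>_. {..<p}))"
  define X where "X r q = card (cands p M (sym_type m r) (fst q) (snd q))" for r q
  have fin\<Omega>: "finite \<Omega>" by (simp add: \<Omega>_def finite_PiE)
  have finQ: "finite Q"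
    unfolding Q_def by (intro finite_SigmaI finite_PiE) (auto intro: finite_subset)
  have cardQ: "card Q = (M choose d) * p ^ d"
  proof -
    have "card Q = (\<Sum>J\<in>{J. J \<subseteq> {..<M} \<and> card J = d}. card (PiE J (\<lambda>_. {..<p})))"
      unfolding Q_def by (intro card_SigmaI) (auto intro!: finite_PiE intro: finite_subset)
    also have "\<dots> = (\<Sum>J\<in>{J. J \<subseteq> {..<M} \<and> card J = d}. p ^ d)"
    proof (intro sum.cong refl)
      fix J assume "J \<in> {J. J \<subseteq> {..<M} \<and> card J = d}"
      moreover from this have "finite J" using finite_subset by blast
      ultimately show "card (PiE J (\<lambda>_. {..<p})) = p ^ d" by (simp add: card_PiE)
    qed
    finally show ?thesis by (simp add: n_subsets)
  qed
  have bad: "1 \<le> (\<Sum>q\<in>Q. s ^ (d - 1) * (1 / s) ^ X r q)" if r: "r \<in> \<Omega>" for r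
  proof -
    have "\<forall>x<M. \<forall>y<M. x \<noteq> y \<longrightarrow>
       sym_type m r x y < p \<and> sym_type m r y x = rev_type m (sym_type m r x y)"
    proof (intro allI impI)
      fix x y assume "x < M" "y < M" "x \<noteq> y"
      then have "up x y \<in> up_pairs M" by (auto simp: up_def up_pairs_def)
      then have "r (up x y) < p" using r by (auto simp: \<Omega>_def)
      then show "sym_type m r x y < p \<and> sym_type m r y x = rev_type m (sym_type m r x y)"
        using \<open>x \<noteq> y\<close> rev_type_less p(1) by (auto simp: sym_type_def up_def split: if_splits)
    qed
    moreover have "\<not> rich m p M d (sym_type m r)" using none by blast
    ultimately have "\<exists>J a. J \<subseteq> {..<M} \<and> card J = d \<and> a ` J \<subseteq> {..<p} \<and>
        \<not> d \<le> card (cands p M (sym_type m r) J a)"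
      unfolding rich_def by blast
    then obtain J a where J: "J \<subseteq> {..<M}" "card J = d" "a ` J \<subseteq> {..<p}"
      "\<not> d \<le> card (cands p M (sym_type m r) J a)"
      by (elim exE conjE)
    \<comment> \<open>Restricting \<open>a\<close> to \<open>J\<close> leaves the candidates
      unchanged and makes the set \<open>Q\<close> of pairs finite.\<close>
    define q where "q = (J, restrict a J)"
    have "q \<in> Q" using J by (auto simp: Q_def q_def)
    have "X r q < d" using J(4) cands_cong[of J "restrict a J" a] by (simp add: X_def q_def)
    then have "(1 / s) ^ (d - 1) \<le> (1 / s) ^ X r q" using s by (intro power_decreasing) auto
    then have "s ^ (d - 1) * (1 / s) ^ (d - 1) \<le> s ^ (d - 1) * (1 / s) ^ X r q"
      using s by (intro mult_left_mono) auto
    then have "1 \<le> s ^ (d - 1) * (1 / s) ^ X r q" using s by (simp add: power_one_over)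
    also have "\<dots> \<le> (\<Sum>q\<in>Q. s ^ (d - 1) * (1 / s) ^ X r q)"
      using \<open>q \<in> Q\<close> finQ s by (intro member_le_sum) auto
    finally show ?thesis .
  qed
  let ?e = "(1 - (1 - 1 / s) * card (layers p) / p ^ d) ^ (M - d)"
  have "real (card \<Omega>) \<le> (\<Sum>r\<in>\<Omega>. \<Sum>q\<in>Q. s ^ (d - 1) * (1 / s) ^ X r q)"
    using sum_mono[OF bad] by simp
  also have "\<dots> = (\<Sum>q\<in>Q. s ^ (d - 1) * (\<Sum>r\<in>\<Omega>. (1 / s) ^ X r q))"
    by (subst sum.swap) (simp add: sum_distrib_left)
  also have "\<dots> \<le> (\<Sum>q\<in>Q. s ^ (d - 1) * (card \<Omega> * ?e))"
  proof (intro sum_mono mult_left_mono)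
    fix q assume "q \<in> Q"
    then have "fst q \<subseteq> {..<M}" "card (fst q) = d" "snd q ` fst q \<subseteq> {..<p}"
      by (auto simp: Q_def)
    then show "(\<Sum>r\<in>\<Omega>. (1 / s) ^ X r q) \<le> card \<Omega> * ?e"
      using sum_power_cands_le[OF p, of "1 / s" "fst q" M d "snd q"] s d
      unfolding X_def \<Omega>_def by simp
  qed (use s in auto)
  also have "\<dots> = card \<Omega> * ((M choose d) * p ^ d * s ^ (d - 1) * ?e)"
    by (simp add: cardQ)
  also have "\<dots> < real (card \<Omega>) * 1"
    using p(2) small by (intro mult_strict_left_mono) (simp_all add: \<Omega>_def card_PiE)
  finally show False by simp
qed

section \<open>Numerical estimates\<close>

lemma one_minus_power_le_exp:
  fixes x :: real
  assumes "0 \<le> x" "x \<le> 1"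
  shows "(1 - x) ^ k \<le> exp (- (x * k))"
proof -
  have "(1 - x) ^ k \<le> exp (- x) ^ k"
    using assms exp_ge_add_one_self[of "- x"] by (intro power_mono) auto
  then show ?thesis by (simp add: exp_of_nat_mult[symmetric] mult.commute)
qed

text \<open>The tangent at \<open>2\<close>, whose constant term \<open>ln 2 - 1\<close> is
  negative.\<close>

lemma ln_le_half:
  fixes x :: real
  assumes "0 < x"
  shows "ln x \<le> x / 2"
proof -
  have "ln x = ln 2 + ln (x / 2)" using assms by (simp add: ln_div)
  also have "\<dots> \<le> 25 / 36 + (x / 2 - 1)"
    using assms ln2_le_25_over_36 ln_le_minus_one[of "x / 2"] by simp
  finally show ?thesis by simp
qed

text \<open>The tangent at \<open>6\<close>, with \<open>ln 6 = 3 * ln 2 + ln (3 / 4)\<close>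
  bounded by \<open>11 / 6\<close>.\<close>

lemma ln_le_sixth:
  fixes x :: real
  assumes "0 < x"
  shows "ln x \<le> 5 / 6 + x / 6"
proof -
  have "ln (8 :: real) = 3 * ln 2" using ln_realpow[of 2 3] by simp
  moreover have "x = 8 * ((3 / 4) * (x / 6))" by simp
  then have eq: "ln x = ln (8 * ((3 / 4) * (x / 6)))" by (rule arg_cong)
  moreover have "ln x = ln 8 + (ln (3 / 4) + ln (x / 6))"
    unfolding eq using assms by (subst ln_mult_pos; (subst ln_mult_pos)?; simp)
  moreover have "ln (3 / 4 :: real) \<le> - 1 / 4" using ln_le_minus_one[of "3 / 4 :: real"] by simp
  moreover have "ln (x / 6) \<le> x / 6 - 1" using assms by (intro ln_le_minus_one) simp
  ultimately show ?thesis using ln2_le_25_over_36 by linarith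
qed

lemma choose_le_pow: "real (M choose d) \<le> real M ^ d"
proof (cases "d \<le> M")
  case True
  then show ?thesis using binomial_le_pow[of d M] by (metis of_nat_le_iff of_nat_power)
qed (simp add: binomial_eq_0)

text \<open>Shaped for \<open>k = p - 1\<close> in the union bound for \<open>p \<ge> 3\<close>. In
  the induction the left side grows by a factor of at least \<open>4\<close>, which outpaces the
  right side.\<close>

lemma power_ge_linear:
  assumes "4 \<le> d" "2 \<le> k"
  shows "real d ^ k \<ge> (real k + 1) * real d + (real k + 1) / 2 + 2"
  using assms(2)
proof (induction k rule: dec_induct)
  case base
  have "real d * d \<ge> 4 * real d" using assms by (intro mult_right_mono) auto
  moreover have "real d \<ge> 4" using assms by simp
  ultimately have "7 / 2 + 3 * real d \<le> real d * d" by linarith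
  then show ?case by (simp add: power2_eq_square)
next
  case (step k)
  have d: "real d \<ge> 4" using assms by simp
  have "0 \<le> real k * real d" by simp
  have "(real (Suc k) + 1) * real d + (real (Suc k) + 1) / 2 + 2 =
      real k * real d + 2 * real d + real k / 2 + 3" by (simp add: field_simps)
  also have "\<dots> \<le> 4 * (real k * real d) + 4 * real d + 2 * real k + 10"
    using d \<open>0 \<le> real k * real d\<close> by linarith
  also have "\<dots> = 4 * ((real k + 1) * real d + (real k + 1) / 2 + 2)" by (simp add: field_simps)
  also have "\<dots> \<le> real d ^ Suc k"
    unfolding power_Suc by (intro mult_mono step.IH d) auto
  finally show ?case .
qed

text \<open>The case of one layer, with \<open>s = 2\<close>. After bounding the binomial by
  \<open>M ^ d\<close> and taking logarithms, the entropy terms are about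
  \<open>d * (p * d + p / 2)\<close>, against the decay \<open>d ^ p\<close> from
  \<open>M / (2 * p ^ d) = d ^ p\<close>.\<close>

lemma union_bound_plain:
  fixes d p :: nat
  assumes "4 \<le> d" "3 \<le> p"
  defines "M \<equiv> 2 * d ^ p * p ^ d"
  shows "(M choose d) * p ^ d * (2 :: real) ^ (d - 1) *
    (1 - (1 - 1 / 2) * card (layers p) / p ^ d) ^ (M - d) < (1 :: real)"
proof -
  define q where "q = real p ^ d"
  have d: "real d \<ge> 4" and p: "real p \<ge> 3" using assms by auto
  have "d < 2 ^ d" by (rule less_exp)
  also have "\<dots> \<le> p ^ d" using assms by (intro power_mono) auto
  finally have q: "1 \<le> q" "d \<le> q" unfolding q_def by (simp_all add: less_imp_le flip: of_nat_power)
  have M: "real M = 2 * real d ^ p * q" by (simp add: M_def q_def)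
  have lnM: "ln (real M) = ln 2 + p * ln d + d * ln p"
    unfolding M q_def using d p by (simp add: ln_mult ln_realpow)
  have dM: "d \<le> M"
  proof -
    have "d \<le> d ^ p" using assms by (intro self_le_power) auto
    moreover have "1 \<le> 2 * p ^ d" using assms by (simp add: Suc_le_eq)
    ultimately have "d * 1 \<le> d ^ p * (2 * p ^ d)" by (rule mult_le_mono)
    then show ?thesis by (simp add: M_def mult_ac)
  qed
  have Mpos: "0 < real M" unfolding M using q d by simp
  \<comment> \<open>Replacing \<open>M\<close> by \<open>M - d\<close> costs
    \<open>d / (2 * q)\<close>, at most \<open>1 / 2\<close> because
    \<open>d \<le> q\<close>.\<close>
  have x: "real (M - d) / (2 * q) \<ge> real d ^ p - 1 / 2"
    using q dM by (simp add: of_nat_diff M field_simps)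
  have cl: "card (layers p) = 1" using assms by (simp add: card_layers)
  have "(1 - 1 / (2 * q)) ^ (M - d) \<le> exp (- (1 / (2 * q) * real (M - d)))"
    using q by (intro one_minus_power_le_exp) auto
  also have "\<dots> \<le> exp (1 / 2 - real d ^ p)" using x by simp
  finally have e: "(1 - 1 / (2 * q)) ^ (M - d) \<le> exp (1 / 2 - real d ^ p)" .
  have e0: "0 \<le> (1 - 1 / (2 * q)) ^ (M - d)" using q by (intro zero_le_power) auto
  have pw: "real M ^ d = exp (d * ln M)" "q = exp (d * ln p)" "(2 :: real) ^ d = exp (d * ln 2)"
    using Mpos p by (simp_all add: q_def exp_of_nat_mult)
  have "(M choose d) * p ^ d * (2 :: real) ^ (d - 1) *
      (1 - (1 - 1 / 2) * card (layers p) / p ^ d) ^ (M - d)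
    = (M choose d) * q * 2 ^ (d - 1) * (1 - 1 / (2 * q)) ^ (M - d)"
    by (simp add: cl q_def)
  also have "\<dots> \<le> real M ^ d * q * 2 ^ d * exp (1 / 2 - real d ^ p)"
    using choose_le_pow[of M d] e e0 q by (intro mult_mono power_increasing) auto
  also have "\<dots> = exp (d * ln M + d * ln p + d * ln 2 + (1 / 2 - real d ^ p))"
    unfolding exp_add pw(2)[symmetric] pw(1)[symmetric] pw(3)[symmetric] by simp
  also have "\<dots> < exp 0"
  proof (subst exp_less_cancel_iff)
    have "real d * ln p \<le> d * (p / 2)" "real p * ln d \<le> p * (d / 2)"
      using ln_le_half[of "real p"] ln_le_half[of "real d"] d p by (simp_all add: mult_left_mono)
    then have "real d * ln p \<le> real p * real d / 2" "real p * ln d \<le> real p * real d / 2"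
      by (simp_all add: mult.commute)
    moreover have "ln p \<le> real p / 2" using ln_le_half p by simp
    ultimately have "ln M + ln p + ln 2 \<le> real p * real d + real p / 2 + 25 / 18"
      using ln2_le_25_over_36 unfolding lnM by linarith
    moreover have "real d ^ (p - 1) \<ge> real p * real d + real p / 2 + 2"
      using power_ge_linear[of d "p - 1"] assms by (simp add: of_nat_diff)
    \<comment> \<open>Here \<open>25 / 18 - 2 \<le> - 1 / 2\<close>. Multiplied by
      \<open>d \<ge> 4\<close>, this margin absorbs the \<open>1 / 2\<close> left in the
      exponent.\<close>
    ultimately have "ln M + ln p + ln 2 - real d ^ (p - 1) \<le> - 1 / 2" by simp
    then have "d * (ln M + ln p + ln 2 - real d ^ (p - 1)) \<le> d * (- 1 / 2)"
      by (intro mult_left_mono) auto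
    moreover have "real d ^ p = d * real d ^ (p - 1)"
      using assms by (simp flip: power_Suc)
    ultimately show "d * ln M + d * ln p + d * ln 2 + (1 / 2 - real d ^ p) < 0"
      using d by (simp add: algebra_simps)
  qed
  finally show ?thesis by simp
qed

text \<open>Two layers with \<open>s = 2 * d\<close>: the factor \<open>1 - 1 / s\<close> then costs
  only a linear term of the decay \<open>2 * d ^ 2\<close>, while \<open>s ^ (d - 1)\<close> adds
  only order \<open>d * ln d\<close> to the exponent.\<close>

lemma union_bound_doubled_large:
  fixes d :: nat
  assumes "6 \<le> d"
  defines "M \<equiv> d ^ 2 * 2 ^ d"
  shows "(M choose d) * 2 ^ d * real (2 * d) ^ (d - 1) *
    (1 - (1 - 1 / real (2 * d)) * 2 / 2 ^ d) ^ (M - d) < (1 :: real)"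
proof -
  define q where "q = (2 :: real) ^ d"
  have d: "real d \<ge> 6" using assms by auto
  have "2 * d \<le> 2 ^ d" using assms(1)
    by (induction d rule: dec_induct) auto
  then have "real (2 * d) \<le> real (2 ^ d)" by (simp only: of_nat_le_iff)
  then have q: "2 * d \<le> q" by (simp add: q_def)
  have q1: "12 \<le> q" using q d by linarith
  have M: "real M = real d ^ 2 * q" by (simp add: M_def q_def)
  have lnM: "ln (real M) = 2 * ln d + d * ln 2"
    unfolding M q_def using d by (simp add: ln_mult ln_realpow)
  have dM: "d \<le> M"
  proof -
    have "d * 1 \<le> d ^ 2 * 2 ^ d"
      using assms by (intro mult_mono) (auto simp: power2_eq_square)
    then show ?thesis by (simp add: M_def)
  qed
  have Mpos: "0 < real M" unfolding M using q1 d by simp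
  define x where "x = (1 - 1 / real (2 * d)) * 2 / q"
  have "x \<le> 1 * 2 / q"
    unfolding x_def using q1 by (intro divide_right_mono mult_right_mono) auto
  also have "\<dots> \<le> 1" using q1 by simp
  finally have x01: "x \<le> 1" .
  have "1 / real (2 * d) \<le> 1" using d by simp
  then have x0: "0 \<le> x" using q1 by (simp add: x_def)
  \<comment> \<open>The main term is \<open>2 * d ^ 2\<close>. The factor
    \<open>1 - 1 / (2 * d)\<close> costs \<open>d\<close>, and passing from \<open>M\<close> to
    \<open>M - d\<close> costs at most \<open>1\<close> because
    \<open>2 * d \<le> q\<close>.\<close>
  have x: "x * real (M - d) \<ge> 2 * real d ^ 2 - d - 1"
  proof -
    have "x * real (M - d) = x * M - x * d" using dM by (simp add: of_nat_diff algebra_simps)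
    also have "x * M = 2 * real d ^ 2 - d"
      using d q1 unfolding x_def M by (simp add: field_simps power2_eq_square)
    finally have eq: "x * real (M - d) = 2 * real d ^ 2 - d - x * d" .
    have "(1 - 1 / real (2 * d)) * 2 * d = 2 * real d - 1" using d by (simp add: field_simps)
    then have "x * d = (2 * real d - 1) / q" by (simp add: x_def)
    also have "\<dots> \<le> 1" using q q1 by simp
    finally show ?thesis using eq by simp
  qed
  have "(1 - x) ^ (M - d) \<le> exp (- (x * real (M - d)))"
    using x0 x01 by (rule one_minus_power_le_exp)
  also have "\<dots> \<le> exp (d + 1 - 2 * real d ^ 2)" using x by simp
  finally have e: "(1 - x) ^ (M - d) \<le> exp (d + 1 - 2 * real d ^ 2)" .
  have pw: "real M ^ d = exp (d * ln M)" "q = exp (d * ln 2)"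
      "real (2 * d) ^ (d - 1) = exp (real (d - 1) * ln (2 * d))"
    using Mpos d by (simp_all only: exp_of_nat_mult) (simp_all add: q_def)
  have "(M choose d) * 2 ^ d * real (2 * d) ^ (d - 1) *
      (1 - (1 - 1 / real (2 * d)) * 2 / 2 ^ d) ^ (M - d)
    = (M choose d) * q * real (2 * d) ^ (d - 1) * (1 - x) ^ (M - d)"
    by (simp add: x_def q_def)
  also have "\<dots> \<le> real M ^ d * q * real (2 * d) ^ (d - 1) * exp (d + 1 - 2 * real d ^ 2)"
    using choose_le_pow[of M d] e q1 x0 x01 by (intro mult_mono) auto
  also have "\<dots> = exp (d * ln M + d * ln 2 + real (d - 1) * ln (2 * d) + (d + 1 - 2 * real d ^ 2))"
    unfolding exp_add pw(2)[symmetric] pw(1)[symmetric] pw(3)[symmetric] by simp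
  also have "\<dots> < exp 0"
  proof (subst exp_less_cancel_iff)
    have ln2: "ln 2 \<le> (25 / 36 :: real)" by (rule ln2_le_25_over_36)
    have lnd: "ln d \<le> 5 / 6 + real d / 6" using d by (intro ln_le_sixth) simp
    have "d * ln M \<le> d * (2 * (5 / 6 + real d / 6) + d * (25 / 36))"
      unfolding lnM using ln2 lnd d by (intro mult_left_mono add_mono) auto
    moreover have "d * ln 2 \<le> d * (25 / 36 :: real)" using ln2 by (intro mult_left_mono) auto
    moreover have "real (d - 1) * ln (2 * d) \<le> (real d - 1) * (25 / 36 + (5 / 6 + real d / 6))"
      using ln2 lnd d assms by (simp add: of_nat_diff ln_mult)
    \<comment> \<open>Factored at \<open>6\<close>, so that the assumption \<open>6 \<le> d\<close>
      settles the sign.\<close>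
    moreover have "d * (2 * (5 / 6 + real d / 6) + d * (25 / 36)) + d * (25 / 36) +
        (real d - 1) * (25 / 36 + (5 / 6 + real d / 6)) + (d + 1 - 2 * real d ^ 2) =
        - 29 / 36 * (real d * (real d - 6)) - real d / 9 - 19 / 36"
      by (simp add: field_simps power2_eq_square)
    moreover have "0 \<le> real d * (real d - 6)" using d by simp
    ultimately show "d * ln M + d * ln 2 + real (d - 1) * ln (2 * d) + (d + 1 - 2 * real d ^ 2) < 0"
      using d by linarith
  qed
  finally show ?thesis by simp
qed

text \<open>Here \<open>256 = 4 ^ 2 * 2 ^ 4\<close> and \<open>s = 10\<close>. The division by
  \<open>4!\<close> in the binomial bound is kept, and the power is rounded up in stages along
  \<open>252 = 4 * 9 * 7\<close> to keep the numbers small.\<close>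

lemma union_bound_doubled_4:
  "(256 choose 4) * 2 ^ 4 * (10 :: real) ^ (4 - 1) * (1 - (1 - 1 / 10) * 2 / 2 ^ 4) ^ (256 - 4) < (1 :: real)"
proof -
  have "fact 4 = (24 :: nat)" by (simp add: fact_numeral)
  then have c: "24 * (256 choose 4) \<le> (256 ^ 4 :: nat)"
    using binomial_fact_pow[of 256 4] by (simp add: mult.commute)
  have "(71 / 80 :: real) ^ 252 = (((71 / 80) ^ 4) ^ 9) ^ 7"
    unfolding power_mult[symmetric] by (rule arg_cong2[where f = power]) simp_all
  also have "\<dots> \<le> ((6205 / 10000) ^ 9) ^ 7"
    by (intro power_mono zero_le_power) (simp_all add: power_divide)
  also have "\<dots> \<le> (137 / 10000) ^ 7"
    by (intro power_mono zero_le_power) (simp_all add: power_divide)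
  finally have e: "(71 / 80 :: real) ^ 252 \<le> (137 / 10000) ^ 7" .
  have "24 * real (256 choose 4) \<le> 256 ^ 4"
    using c by (metis of_nat_le_iff of_nat_mult of_nat_numeral of_nat_power)
  then have "real (256 choose 4) * 16000 * (71 / 80) ^ 252 \<le> (256 ^ 4 / 24) * 16000 * (137 / 10000) ^ 7"
    by (intro mult_mono e zero_le_power mult_nonneg_nonneg) auto
  also have "\<dots> < 1" by (simp add: power_divide)
  finally have less: "real (256 choose 4) * 16000 * (71 / 80) ^ 252 < 1" .
  have "1 - (1 - 1 / 10) * 2 / 2 ^ 4 = (71 / 80 :: real)" "256 - 4 = (252 :: nat)" by simp_all
  moreover have "real (c * 2 ^ 4) * 10 ^ (4 - 1) = real c * 16000" for c by simp
  ultimately show ?thesis using less by (simp only:)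
qed

text \<open>As for \<open>d = 4\<close>, with \<open>800 = 5 ^ 2 * 2 ^ 5\<close>.\<close>

lemma union_bound_doubled_5:
  "(800 choose 5) * 2 ^ 5 * (10 :: real) ^ (5 - 1) * (1 - (1 - 1 / 10) * 2 / 2 ^ 5) ^ (800 - 5) < (1 :: real)"
proof -
  have "fact 5 = (120 :: nat)" by (simp add: fact_numeral)
  then have c: "120 * (800 choose 5) \<le> (800 ^ 5 :: nat)"
    using binomial_fact_pow[of 800 5] by (simp add: mult.commute)
  \<comment> \<open>Dropping \<open>15\<close> factors leaves an exponent with small divisors,
    \<open>780 = 15 * 13 * 4\<close>.\<close>
  have "(151 / 160 :: real) ^ 795 \<le> (151 / 160) ^ 780" by (rule power_decreasing) simp_all
  also have "\<dots> = (((151 / 160) ^ 15) ^ 13) ^ 4"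
    unfolding power_mult[symmetric] by (rule arg_cong2[where f = power]) simp_all
  also have "\<dots> \<le> ((42 / 100) ^ 13) ^ 4"
    by (intro power_mono zero_le_power) (simp_all add: power_divide)
  also have "\<dots> \<le> (13 / 1000000) ^ 4"
    by (intro power_mono zero_le_power) (simp_all add: power_divide)
  finally have e: "(151 / 160 :: real) ^ 795 \<le> (13 / 1000000) ^ 4" .
  have "120 * real (800 choose 5) \<le> 800 ^ 5"
    using c by (metis of_nat_le_iff of_nat_mult of_nat_numeral of_nat_power)
  then have "real (800 choose 5) * 320000 * (151 / 160) ^ 795 \<le> (800 ^ 5 / 120) * 320000 * (13 / 1000000) ^ 4"
    by (intro mult_mono e zero_le_power mult_nonneg_nonneg) auto
  also have "\<dots> < 1" by (simp add: power_divide)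
  finally have less: "real (800 choose 5) * 320000 * (151 / 160) ^ 795 < 1" .
  have "1 - (1 - 1 / 10) * 2 / 2 ^ 5 = (151 / 160 :: real)" "800 - 5 = (795 :: nat)" by simp_all
  moreover have "real (c * 2 ^ 5) * 10 ^ (5 - 1) = real c * 320000" for c by simp
  ultimately show ?thesis using less by (simp only:)
qed

lemma union_bound_doubled:
  fixes d M :: nat
  assumes "4 \<le> d" "M = d ^ 2 * 2 ^ d"
  shows "\<exists>s :: real. 1 < s \<and> real ((M choose d) * 2 ^ d) * s ^ (d - 1) *
    (1 - (1 - 1 / s) * 2 / 2 ^ d) ^ (M - d) < 1"
proof -
  consider "d = 4" | "d = 5" | "6 \<le> d" using assms(1) by linarith
  then show ?thesis
  proof cases
    case 1
    then have "M = 256" using assms(2) by simp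
    show ?thesis unfolding 1 \<open>M = 256\<close>
      by (rule exI[of _ 10], rule conjI, simp, rule union_bound_doubled_4)
  next
    case 2
    then have "M = 800" using assms(2) by simp
    show ?thesis unfolding 2 \<open>M = 800\<close>
      by (rule exI[of _ 10], rule conjI, simp, rule union_bound_doubled_5)
  next
    case 3
    show ?thesis unfolding assms(2)
      by (rule exI[of _ "real (2 * d)"], rule conjI, use 3 in simp, rule union_bound_doubled_large[OF 3])
  qed
qed

section \<open>Degeneracy orderings and the target graph\<close>

definition neighbors :: "'a sgraph \<Rightarrow> 'a \<Rightarrow> 'a set" where
  "neighbors G v = {u. {u, v} \<in> edges G}"

lemma simple_graph_edgeD:
  assumes "simple_graph G" "{u, v} \<in> edges G"
  shows "u \<noteq> v" "u \<in> verts G" "v \<in> verts G"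
proof -
  have "{u, v} \<subseteq> verts G" "card {u, v} = 2" using assms unfolding simple_graph_def by blast+
  then show "u \<noteq> v" "u \<in> verts G" "v \<in> verts G" by auto
qed

lemma finite_edges: "simple_graph G \<Longrightarrow> finite (edges G)"
  by (rule finite_subset[of _ "Pow (verts G)"]) (auto simp: simple_graph_def)

lemma card_neighbors:
  assumes "simple_graph G"
  shows "card (neighbors G v) = Defs.degree G v"
  unfolding Defs.degree_def
proof (rule bij_betw_same_card, rule bij_betwI')
  fix u w assume "u \<in> neighbors G v" "w \<in> neighbors G v"
  then show "({u, v} = {w, v}) = (u = w)" by (auto simp: doubleton_eq_iff)
next
  fix u assume "u \<in> neighbors G v"
  then show "{u, v} \<in> {e \<in> edges G. v \<in> e}" by (simp add: neighbors_def)
next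
  fix e assume e: "e \<in> {e \<in> edges G. v \<in> e}"
  then have "card e = 2" using assms by (simp add: simple_graph_def)
  then obtain u where "e = {u, v}" using e by (auto simp: card_2_iff insert_commute)
  then show "\<exists>u\<in>neighbors G v. e = {u, v}" using e by (auto simp: neighbors_def)
qed

text \<open>The \<open>LEAST\<close> is attained, since the number of edges bounds every degree in
  every subgraph.\<close>

lemma degenerate_degeneracy:
  assumes "simple_graph G"
  shows "degenerate (degeneracy G) G"
proof -
  have "Defs.degree S v \<le> card (edges G)" if "subgraph S G" for S v
  proof -
    have "{e \<in> edges S. v \<in> e} \<subseteq> edges G" using that by (auto simp: subgraph_def)
    then show ?thesis unfolding Defs.degree_def by (rule card_mono[OF finite_edges[OF assms]])
  qed
  then have "degenerate (card (edges G)) G" by (fastforce simp: degenerate_def)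
  then show ?thesis unfolding degeneracy_def by (rule LeastI)
qed

text \<open>A vertex of degree at most \<open>d\<close> in the subgraph induced on \<open>W\<close>
  is placed last, and the rest is ordered by induction.\<close>

lemma degenerate_ordering:
  assumes "simple_graph G" "degenerate d G" "W \<subseteq> verts G"
  shows "\<exists>vs. distinct vs \<and> set vs = W \<and>
    (\<forall>xs v ys. vs = xs @ v # ys \<longrightarrow> card (set xs \<inter> neighbors G v) \<le> d)"
  using assms(3)
proof (induction "card W" arbitrary: W)
  case 0
  then have "W = {}" using assms(1) finite_subset by (fastforce simp: simple_graph_def)
  then show ?case by (intro exI[of _ "[]"]) simp
next
  case (Suc k)
  have fin: "finite W" using Suc.hyps(2) card_ge_0_finite by force
  define S where "S = \<lparr>verts = W, edges = {e \<in> edges G. e \<subseteq> W}\<rparr>"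
  have S: "simple_graph S" using assms(1) fin by (simp add: S_def simple_graph_def)
  have "subgraph S G" using S Suc.prems by (auto simp: S_def subgraph_def)
  moreover have W: "verts S = W" by (simp add: S_def)
  moreover have "W \<noteq> {}" using Suc.hyps(2) by auto
  ultimately obtain v where v: "v \<in> W" "Defs.degree S v \<le> d"
    using assms(2) unfolding degenerate_def by metis
  have "k = card (W - {v})" "W - {v} \<subseteq> verts G" using Suc v fin by auto
  from Suc.hyps(1)[OF this] obtain vs where vs: "distinct vs" "set vs = W - {v}"
    "\<And>xs u ys. vs = xs @ u # ys \<Longrightarrow> card (set xs \<inter> neighbors G u) \<le> d" by metis
  have "card (W \<inter> neighbors G v) \<le> d"
  proof -
    have "W \<inter> neighbors G v = neighbors S v"
      using v by (auto simp: neighbors_def S_def dest: simple_graph_edgeD[OF S])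
    then show ?thesis using card_neighbors[OF S] v by simp
  qed
  then have last: "card (set vs \<inter> neighbors G v) \<le> d"
    using card_mono[of "W \<inter> neighbors G v" "set vs \<inter> neighbors G v"] fin vs(2) by fastforce
  have "card (set xs \<inter> neighbors G u) \<le> d" if "vs @ [v] = xs @ u # ys" for xs u ys
  proof (cases ys rule: rev_cases)
    case Nil
    then show ?thesis using that last by simp
  next
    case (snoc ys' y)
    then show ?thesis using that vs(3)[of xs u ys'] by simp
  qed
  then show ?case using vs v by (intro exI[of _ "vs @ [v]"]) auto
qed

section \<open>Types in the given graph and the target graph\<close>

lemma ex_conn_edge:
  assumes "colored_mixed_graph m n G" "{u, v} \<in> edges (underlying G)"
  shows "\<exists>k < 2 * m + n. conn m k u v \<in> conns G"
proof -
  obtain c where c: "c \<in> conns G" "endpoints c = {u, v}"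
    using assms(2) by (auto simp: underlying_def)
  have "u \<noteq> v" using assms simple_graph_edgeD by (metis colored_mixed_graph_def)
  then show ?thesis using ex_conn[of m n c u v] c assms(1) by (auto simp: colored_mixed_graph_def)
qed

text \<open>Injectivity of \<open>endpoints\<close> leaves one connection between \<open>u\<close>
  and \<open>v\<close>, and \<open>u \<noteq> v\<close> makes its direction recoverable.\<close>

lemma conn_type_unique:
  assumes "colored_mixed_graph m n G" "conn m k u v \<in> conns G" "conn m l u v \<in> conns G"
  shows "k = l"
proof -
  have "u \<noteq> v" using assms simple_graph_edgeD[of "underlying G" u v]
    by (force simp: colored_mixed_graph_def underlying_def)
  moreover have "conn m k u v = conn m l u v"
    using assms(1) inj_onD[OF _ _ assms(2,3), of endpoints]
    by (simp add: colored_mixed_graph_def)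
  ultimately show ?thesis by (auto simp: conn_def split: if_splits)
qed

text \<open>Every unordered pair is listed from both ends; the two listings give the same connection
  when the types are mutually reversed.\<close>

definition target_conns ::
    "nat \<Rightarrow> nat \<Rightarrow> nat \<Rightarrow> (nat \<Rightarrow> nat \<Rightarrow> nat) \<Rightarrow> (nat \<times> bool \<Rightarrow> nat) \<Rightarrow> nat connection set" where
  "target_conns m p M \<rho> h = {conn m (target_type \<rho> y z) (h y) (h z) |y z.
     y \<in> {..<M} \<times> layers p \<and> z \<in> {..<M} \<times> layers p \<and> fst y \<noteq> fst z}"

lemma chi_mixed_le:
  fixes G :: "'a mixed_graph"
  assumes G: "colored_mixed_graph m n G" and p: "p = 2 * m + n" "2 \<le> p" and d: "0 < d" "d \<le> M"
    and rich: "rich m p M d \<rho>"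
    and deg: "degenerate d (underlying G)"
    and max: "\<And>v. v \<in> mverts G \<Longrightarrow> Defs.degree (underlying G) v \<le> d + 1"
  shows "chi_mixed m n G \<le> M * card (layers p)"
proof -
  let ?U = "underlying G"
  have U: "simple_graph ?U" using G by (simp add: colored_mixed_graph_def)
  have vU [simp]: "verts ?U = mverts G" by (simp add: underlying_def)
  define N where "N = neighbors ?U"
  have N_iff: "u \<in> N v \<longleftrightarrow> {u, v} \<in> edges ?U" for u v by (simp add: N_def neighbors_def)
  \<comment> \<open>Meaningful only for neighbours, where existence and uniqueness of the type
    hold.\<close>
  define t where "t u v = (THE k. k < p \<and> conn m k u v \<in> conns G)" for u v
  have t: "t u v < p \<and> conn m (t u v) u v \<in> conns G" if uv: "u \<in> N v" for u v
  proof -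
    obtain k where k: "k < p \<and> conn m k u v \<in> conns G"
      using ex_conn_edge[OF G uv[unfolded N_iff]] unfolding p(1)[symmetric] by blast
    have "x = k" if "x < p \<and> conn m x u v \<in> conns G" for x
      using conn_type_unique[OF G, of x u v k] that k by simp
    with k show ?thesis unfolding t_def by (rule theI[of "\<lambda>k. k < p \<and> conn m k u v \<in> conns G"])
  qed
  have Nsym: "v \<in> N u" if "u \<in> N v" for u v using that by (simp add: N_iff insert_commute)
  have t_rev: "t v u = rev_type m (t u v)" if "u \<in> N v" for u v
    using t[OF that] t[OF Nsym[OF that]] conn_type_unique[OF G, of "t v u" v u "rev_type m (t u v)"]
    by (simp add: conn_rev_type)
  obtain vs where vs: "distinct vs" "set vs = mverts G"
    "\<And>xs v ys. vs = xs @ v # ys \<Longrightarrow> card (set xs \<inter> N v) \<le> d"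
    using degenerate_ordering[OF U deg, of "mverts G"] N_def by auto
  \<comment> \<open>The whole order is coloured, so the invariant on uncoloured vertices becomes
    vacuous.\<close>
  have "\<exists>f. f ` set vs \<subseteq> {..<M} \<times> layers p \<and>
    (\<forall>v\<in>set vs. \<forall>w\<in>set vs. w \<in> N v \<longrightarrow> fst (f v) \<noteq> fst (f w) \<and> target_type \<rho> (f w) (f v) = t w v) \<and>
    (\<forall>u\<in>set []. \<forall>w\<in>set vs \<inter> N u. \<forall>w'\<in>set vs \<inter> N u. fst (f w) = fst (f w') \<longrightarrow>
        twist (snd (f w)) (t w u) = twist (snd (f w')) (t w' u))"
  proof (rule greedy_coloring[OF p d rich Nsym, where vs = vs])
    show "v \<notin> N v" for v using simple_graph_edgeD(1)[OF U, of v v] by (auto simp: N_iff)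
    show "N v \<subseteq> set vs" for v using simple_graph_edgeD(2)[OF U] vs(2) by (auto simp: N_iff)
    show "card (N v) \<le> d + 1" if "v \<in> set vs" for v
      using max that vs(2) card_neighbors[OF U] by (simp add: N_def)
    show "t u v < p \<and> t v u = rev_type m (t u v)" if "u \<in> N v" for u v
      using t[OF that] t_rev[OF that] by simp
  qed (use vs in auto)
  then obtain f where f: "f ` mverts G \<subseteq> {..<M} \<times> layers p"
    and hom: "\<forall>v\<in>mverts G. \<forall>w\<in>mverts G. w \<in> N v \<longrightarrow>
      fst (f v) \<noteq> fst (f w) \<and> target_type \<rho> (f w) (f v) = t w v"
    unfolding vs(2) by (elim exE conjE)
  let ?W = "{..<M} \<times> layers p"
  have finW: "finite ?W" by simp
  \<comment> \<open>Relabels the target by natural numbers, over which \<open>chi_mixed\<close>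
    ranges.\<close>
  obtain h :: "nat \<times> bool \<Rightarrow> nat" where h: "inj_on h ?W"
    using finite_imp_inj_to_nat_seg[OF finW] by blast
  define H where "H = \<lparr>mverts = h ` ?W, conns = target_conns m p M \<rho> h\<rparr>"
  have \<rho>: "\<rho> x y < p" "\<rho> y x = rev_type m (\<rho> x y)" if "x < M" "y < M" "x \<noteq> y" for x y
    using rich that unfolding rich_def by blast+
  have ty: "target_type \<rho> y z < p" "target_type \<rho> z y = rev_type m (target_type \<rho> y z)"
    if "y \<in> ?W" "z \<in> ?W" "fst y \<noteq> fst z" for y z
  proof -
    have x: "(snd y \<noteq> snd z) \<in> layers p" using that by (intro xor_layers) auto
    have r: "\<rho> (fst y) (fst z) < p" "\<rho> (fst z) (fst y) = rev_type m (\<rho> (fst y) (fst z))"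
      using \<rho>[of "fst y" "fst z"] that by auto
    show "target_type \<rho> y z < p" unfolding target_type_def by (rule twist_less[OF x r(1)])
    show "target_type \<rho> z y = rev_type m (target_type \<rho> y z)"
      unfolding target_type_def r(2) neq_commute[of "snd z"]
      using twist_rev_type x r(1) p(1) by simp
  qed
  have "colored_mixed_graph m n H"
    unfolding colored_mixed_graph_def
  proof (intro conjI ballI)
    fix c assume "c \<in> conns H"
    then obtain y z where "c = conn m (target_type \<rho> y z) (h y) (h z)"
      "y \<in> ?W" "z \<in> ?W" "fst y \<noteq> fst z"
      unfolding H_def target_conns_def by auto
    then show "color_ok m n c" using ty(1)[of y z] color_ok_conn[of _ m n] p(1) by simp
  next
    show "simple_graph (underlying H)"
      unfolding simple_graph_def
    proof (intro conjI ballI)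
      fix e assume "e \<in> edges (underlying H)"
      then obtain y z where e: "e = {h y, h z}" and yz: "y \<in> ?W" "z \<in> ?W" "fst y \<noteq> fst z"
        unfolding underlying_def H_def target_conns_def by auto
      then have "h y \<noteq> h z" using inj_onD[OF h] by metis
      then show "card e = 2" using e by simp
      show "e \<subseteq> verts (underlying H)" using e yz by (simp add: underlying_def H_def)
    qed (simp add: underlying_def H_def)
  next
    show "inj_on endpoints (conns H)"
    proof (rule inj_onI)
      fix c c' assume "c \<in> conns H" "c' \<in> conns H" and eq: "endpoints c = endpoints c'"
      then obtain y z y' z' where c: "c = conn m (target_type \<rho> y z) (h y) (h z)"
        "c' = conn m (target_type \<rho> y' z') (h y') (h z')"
        and W: "y \<in> ?W" "z \<in> ?W" "fst y \<noteq> fst z" "y' \<in> ?W" "z' \<in> ?W"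
        unfolding H_def target_conns_def by auto
      have "{h y, h z} = {h y', h z'}" using eq c by simp
      \<comment> \<open>In the second case the connection is read from its other end, and reversing
        the type gives it back.\<close>
      then have "y = y' \<and> z = z' \<or> y = z' \<and> z = y'"
        using inj_onD[OF h] W by (metis doubleton_eq_iff)
      then show "c = c'"
        using c ty(2)[OF W(1-3)] by (auto simp: conn_rev_type)
    qed
  qed
  moreover have "card (mverts H) = M * card (layers p)"
    using card_image[OF h] by (simp add: H_def card_cartesian_product)
  moreover have "colored_hom G H (h \<circ> f)"
    unfolding colored_hom_def
  proof (intro conjI ballI)
    show "(h \<circ> f) ` mverts G \<subseteq> mverts H" using f by (auto simp: H_def)
    fix c assume c: "c \<in> conns G"
    then have e: "endpoints c \<in> edges ?U" by (simp add: underlying_def)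
    then have "card (endpoints c) = 2" using U by (simp add: simple_graph_def)
    then obtain u v where uv: "endpoints c = {u, v}" by (auto simp: card_2_iff)
    then have uN: "u \<in> N v" and V: "u \<in> mverts G" "v \<in> mverts G"
      using e simple_graph_edgeD[OF U, of u v] by (auto simp: N_iff)
    have "c = conn m (t u v) u v"
      using t[OF uN] uv c G inj_onD[of endpoints "conns G" c "conn m (t u v) u v"]
      by (simp add: colored_mixed_graph_def)
    then have "image_connection (h \<circ> f) c = conn m (target_type \<rho> (f u) (f v)) (h (f u)) (h (f v))"
      using hom V uN by (simp add: image_conn)
    moreover have "fst (f u) \<noteq> fst (f v)" using hom V uN by force
    moreover have "f u \<in> ?W" "f v \<in> ?W" using f V by blast+
    ultimately show "image_connection (h \<circ> f) c \<in> conns H"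
      unfolding H_def target_conns_def mixed_graph.select_convs mem_Collect_eq
      by (intro exI[of _ "f u"] exI[of _ "f v"]) simp
  qed
  ultimately show ?thesis unfolding chi_mixed_def by (intro Least_le) blast
qed

section \<open>Assembling the bound\<close>

lemma ex_rich_bound:
  assumes p: "p = 2 * m + n" "2 \<le> p" and d: "4 \<le> d"
  shows "\<exists>M \<rho>. d \<le> M \<and> rich m p M d \<rho> \<and> M * card (layers p) = 2 * d ^ p * p ^ d"
proof (cases "p = 2")
  case True
  \<comment> \<open>Half of the allowed order; the layer of antitwins supplies the factor
    \<open>2\<close>.\<close>
  define M where "M = d ^ 2 * 2 ^ d"
  have cl: "card (layers p) = 2" using True by (simp add: card_layers)
  obtain s :: real where "1 < s" "(M choose d) * 2 ^ d * s ^ (d - 1) *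
      (1 - (1 - 1 / s) * 2 / 2 ^ d) ^ (M - d) < 1"
    using union_bound_doubled[OF d M_def] by blast
  then obtain \<rho> where "rich m p M d \<rho>"
    using ex_rich[OF p, of s d M] d cl True by auto
  moreover have "d * 1 \<le> d ^ 2 * 2 ^ d"
    using d by (intro mult_le_mono) (auto simp: power2_eq_square)
  ultimately show ?thesis using True cl by (intro exI[of _ M] exI[of _ \<rho>]) (simp add: M_def)
next
  case False
  define M where "M = 2 * d ^ p * p ^ d"
  have p3: "3 \<le> p" using p False by simp
  obtain \<rho> where "rich m p M d \<rho>"
    using ex_rich[OF p, of 2 d M] union_bound_plain[OF d p3] d by (auto simp: M_def)
  moreover have "d * 1 \<le> (2 * d ^ p) * p ^ d"
  proof (rule mult_le_mono)
    have "d \<le> d ^ p" using d p by (intro self_le_power) auto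
    then show "d \<le> 2 * d ^ p" by linarith
  qed (use p(2) in \<open>simp add: Suc_le_eq\<close>)
  ultimately show ?thesis using False
    by (intro exI[of _ M] exI[of _ \<rho>]) (simp add: M_def card_layers)
qed

text \<open>Ensures that the \<open>Max\<close> in \<open>chi_graph\<close> is taken over a nonempty
  set; every edge may receive type \<open>0\<close>.\<close>

lemma ex_colored_mixed_graph:
  assumes "simple_graph G" "0 < 2 * m + n"
  shows "\<exists>G'. colored_mixed_graph m n G' \<and> underlying G' = G"
proof -
  have "\<exists>c. color_ok m n c \<and> endpoints c = e" if "e \<in> edges G" for e
  proof -
    have "card e = 2" using assms that by (simp add: simple_graph_def)
    then obtain u v where "e = {u, v}" by (auto simp: card_2_iff)
    then show ?thesis using color_ok_conn[OF assms(2), of u v] by (intro exI[of _ "conn m 0 u v"]) simp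
  qed
  then obtain c where c: "\<And>e. e \<in> edges G \<Longrightarrow> color_ok m n (c e) \<and> endpoints (c e) = e" by metis
  let ?G = "\<lparr>mverts = verts G, conns = c ` edges G\<rparr>"
  have "endpoints ` c ` edges G = edges G" using c by (force simp: image_image)
  then have "underlying ?G = G" by (simp add: underlying_def)
  moreover have "inj_on endpoints (c ` edges G)" using c by (auto simp: inj_on_def)
  ultimately show ?thesis using c assms(1)
    by (intro exI[of _ ?G]) (auto simp: colored_mixed_graph_def)
qed

theorem theorem6:
  fixes m n p \<Delta> :: nat
  assumes "p = 2 * m + n"
    and "p \<ge> 2"
    and "\<Delta> \<ge> 5"
  shows "chi_family m n (degenerate_family \<Delta> :: 'a sgraph set)
           \<le> enat (2 * (\<Delta> - 1) ^ p * p ^ (\<Delta> - 1))"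
  unfolding chi_family_def
proof (rule SUP_least)
  fix G :: "'a sgraph" assume "G \<in> degenerate_family \<Delta>"
  then have G: "simple_graph G" "max_degree G = \<Delta>" "degeneracy G = \<Delta> - 1"
    by (auto simp: degenerate_family_def)
  define d where "d = \<Delta> - 1"
  have d: "4 \<le> d" "d + 1 = \<Delta>" using assms(3) by (auto simp: d_def)
  obtain M \<rho> where M: "d \<le> M" "rich m p M d \<rho>" "M * card (layers p) = 2 * d ^ p * p ^ d"
    using ex_rich_bound[OF assms(1,2) d(1)] by blast
  let ?X = "{chi_mixed m n G' |G'. colored_mixed_graph m n G' \<and> underlying G' = G}"
  have "x \<le> 2 * d ^ p * p ^ d" if x: "x \<in> ?X" for x
  proof -
    obtain G' where G': "x = chi_mixed m n G'" "colored_mixed_graph m n G'" "underlying G' = G"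
      using x by blast
    have v: "mverts G' = verts G" using G'(3) by (auto simp: underlying_def)
    have "Defs.degree G v \<le> d + 1" if "v \<in> verts G" for v
      using that G d(2) by (auto simp: max_degree_def simple_graph_def)
    then have "chi_mixed m n G' \<le> M * card (layers p)"
      using degenerate_degeneracy[OF G(1)] d M G' G
      by (intro chi_mixed_le[OF G'(2) assms(1,2)]) (auto simp: v d_def)
    then show ?thesis using M G' by simp
  qed
  \<comment> \<open>The uniform bound also gives the finiteness that \<open>Max\<close>
    requires.\<close>
  moreover from this have "finite ?X" by (meson finite_nat_set_iff_bounded_le)
  moreover have "?X \<noteq> {}" using ex_colored_mixed_graph[OF G(1), of m n] assms(1,2) by force
  ultimately show "enat (chi_graph m n G) \<le> enat (2 * (\<Delta> - 1) ^ p * p ^ (\<Delta> - 1))"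
    unfolding chi_graph_def d_def by simp
qed

end
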